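(* Let $\ell_1,\dots,\ell_n:\mathbb{R}^d\to\mathbb{R}$ be continuously differentiable functions whose gradients are $L$-Lipschitz continuous ($L>0$), with $\inf_{x\in\mathbb{R}^d}\ell_i(x)>-\infty$ for every $i$. Let $f:=\frac1n\sum_{i=1}^n\ell_i$, let $\mathcal{X}_i^*$ be the set of global minimizers of $\ell_i$, and assume that $\mathcal{X}^*:=\bigcap_{i=1}^n\mathcal{X}_i^*$ is non-empty and bounded. Let $0<\eta<\frac1L$, and let $\{x_k\}_{k\ge 0}$ be the sequence generated from an initial point $x_0\in\mathbb{R}^d$ by SGD with learning rate $\eta$ and cyclic sampling with reshuffle, with sampled indices $\xi_k$. Assume that SGD follows an iterationwise star-convex path, i.e. for all $k=0,1,2,\dots$ and for every $x^*\in\mathcal{X}_{\xi_k}^*$, $$\ell_{\xi_k}(x_k)-\ell_{\xi_k}(x^* )+\langle x^*-x_k,\nabla\ell_{\xi_k}(x_k)\rangle\le 0 .$$ Then the variance of the stochastic gradients converges to zero as $k\to\infty$, i.e. $$\lim_{k\to\infty}\frac1n\sum_{i=1}^n\big\|\nabla\ell_i(x_k)-\nabla f(x_k)\big\|^2=0 .$$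
   Context: The underlying problem is $\min_{x\in\mathbb{R}^d} f(x)$. $\|\cdot\|$ and $\langle\cdot,\cdot\rangle$ are the Euclidean norm and inner product. SGD with cyclic sampling with reshuffle: for each epoch $B=0,1,2,\dots$, $\pi_B$ is a (randomly drawn) permutation of $\{1,\dots,n\}$. Every iteration index is written $k=nB+t$ with $B\ge 0$ and $t\in\{0,\dots,n-1\}$, the sampled index is $\xi_k=\pi_B(t+1)$, and the update is $x_{k+1}=x_k-\eta\nabla\ell_{\xi_k}(x_k)$ for $k=0,1,2,\dots$. The hypothesis and the conclusion both concern the realized path, for the realized sequence of permutations. The variance of the stochastic gradient at a point $x$ is the variance of $\nabla\ell_i(x)$ over the data index $i$ uniform in $\{1,\dots,n\}$, namely $\frac1n\sum_{i=1}^n\|\nabla\ell_i(x)-\nabla f(x)\|^2$. *)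

theory Defs
  imports "HOL-Analysis.Analysis"
begin

definition gradient :: "('a::real_inner \<Rightarrow> real) \<Rightarrow> 'a \<Rightarrow> 'a" where
  "gradient g x = (THE D. GDERIV g x :> D)"

text \<open>At points of differentiability the gradient exists and is unique, so the description
  operator above is harmless there.\<close>

lemma gradient_eqI:
  assumes "GDERIV g x :> D"
  shows "gradient g x = D"
  unfolding gradient_def
proof (rule the_equality)
  fix D' assume "GDERIV g x :> D'"
  then have "(\<lambda>h. inner h D') = (\<lambda>h. inner h D)"
    using assms unfolding gderiv_def by (rule has_derivative_unique)
  then have "inner (D' - D) (D' - D) = 0"
    by (metis inner_diff_right right_minus_eq)
  then show "D' = D"
    by simp
qed (rule assms)

lemma GDERIV_gradient:
  fixes g :: "'a::euclidean_space \<Rightarrow> real"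
  assumes "g differentiable (at x)"
  shows "GDERIV g x :> gradient g x"
proof -
  obtain g' where g': "(g has_derivative g') (at x)"
    using assms unfolding differentiable_def by blast
  have "g' = (\<lambda>h. inner h (adjoint g' 1))"
    using adjoint_works[OF has_derivative_linear[OF g'], of _ 1] by simp
  then have "GDERIV g x :> adjoint g' 1"
    using g' unfolding gderiv_def by metis
  then show ?thesis
    using gradient_eqI by metis
qed

definition continuously_differentiable :: "('a::real_inner \<Rightarrow> real) \<Rightarrow> bool" where
  "continuously_differentiable g \<longleftrightarrow>
    (\<forall>x. g differentiable (at x)) \<and> continuous_on UNIV (gradient g)"

definition global_minimizers :: "('a \<Rightarrow> real) \<Rightarrow> 'a set" where
  "global_minimizers g = {x. is_arg_min g (\<lambda>_. True) x}"

definition mean_loss :: "nat \<Rightarrow> (nat \<Rightarrow> 'a \<Rightarrow> real) \<Rightarrow> 'a \<Rightarrow> real" where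
  "mean_loss n l x = (1 / real n) * (\<Sum>i=1..n. l i x)"

text \<open>\<open>p B\<close> is the permutation of the data indices realized in epoch \<open>B\<close>, and \<open>\<xi> k\<close> is
  the data index used in iteration \<open>k\<close>. Indices of data start at 1, positions in an epoch at 0.\<close>

definition cyclic_sampling_with_reshuffle ::
    "nat \<Rightarrow> (nat \<Rightarrow> nat \<Rightarrow> nat) \<Rightarrow> (nat \<Rightarrow> nat) \<Rightarrow> bool" where
  "cyclic_sampling_with_reshuffle n p \<xi> \<longleftrightarrow>
    (\<forall>B. p B permutes {1..n}) \<and> (\<forall>B. \<forall>t<n. \<xi> (n * B + t) = p B (t + 1))"

definition sgd_sequence ::
    "(nat \<Rightarrow> 'a::real_inner \<Rightarrow> real) \<Rightarrow> real \<Rightarrow> (nat \<Rightarrow> nat) \<Rightarrow> 'a \<Rightarrow> (nat \<Rightarrow> 'a) \<Rightarrow> bool" where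
  "sgd_sequence l \<eta> \<xi> x0 x \<longleftrightarrow>
    x 0 = x0 \<and> (\<forall>k. x (Suc k) = x k - \<eta> *\<^sub>R gradient (l (\<xi> k)) (x k))"

definition iterationwise_star_convex_path ::
    "(nat \<Rightarrow> 'a::real_inner \<Rightarrow> real) \<Rightarrow> (nat \<Rightarrow> nat) \<Rightarrow> (nat \<Rightarrow> 'a) \<Rightarrow> bool" where
  "iterationwise_star_convex_path l \<xi> x \<longleftrightarrow>
    (\<forall>k. \<forall>x' \<in> global_minimizers (l (\<xi> k)).
      l (\<xi> k) (x k) - l (\<xi> k) x' + inner (x' - x k) (gradient (l (\<xi> k)) (x k)) \<le> 0)"

text \<open>Variance of the gradient of the loss at a data index drawn uniformly from \<open>{1..n}\<close>.\<close>

definition stochastic_gradient_variance ::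
    "nat \<Rightarrow> (nat \<Rightarrow> 'a::real_inner \<Rightarrow> real) \<Rightarrow> 'a \<Rightarrow> real" where
  "stochastic_gradient_variance n l x =
    (1 / real n) * (\<Sum>i=1..n. (norm (gradient (l i) x - gradient (mean_loss n l) x))\<^sup>2)"

end

theory Submission
  imports Defs
begin

text \<open>Fix a common minimizer. By star-convexity along the path and the bound
  \<open>\<parallel>\<nabla>g\<parallel>\<^sup>2 \<le> 2 L (g - min g)\<close> for functions with Lipschitz gradient,
  each step decreases the squared distance to this minimizer by at least
  \<open>\<eta> (1/L - \<eta>) \<parallel>\<nabla>\<ell>\<^bsub>\<xi> k\<^esub> (x k)\<parallel>\<^sup>2\<close>. Hence the sampled gradients, and with them the
  increments of the path, tend to zero. As every index is sampled within the next \<open>2 n\<close> iterations,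
  Lipschitz continuity carries this over to all gradients \<open>\<nabla>\<ell>\<^sub>i (x k)\<close>.\<close>

lemma lipschitz_gradient_quadratic_upper_bound:
  fixes g :: "'a::euclidean_space \<Rightarrow> real"
  assumes "\<And>x. g differentiable (at x)" and "L-lipschitz_on UNIV (gradient g)"
  shows "g (x + d) \<le> g x + inner d (gradient g x) + L / 2 * (norm d)\<^sup>2"
proof -
  \<comment> \<open>\<open>h\<close> is \<open>g\<close> on the segment from \<open>x\<close> to
    \<open>x + d\<close> minus the linear and quadratic terms of the bound, so the claim is
    \<open>h 1 \<le> h 0\<close>. Its derivative \<open>h'\<close> is nonpositive for
    \<open>t \<ge> 0\<close> by Cauchy-Schwarz and the Lipschitz bound; monotonicity then replaces
    integration of the gradient.\<close>
  define h where "h t = g (x + t *\<^sub>R d) - t * inner d (gradient g x) - L / 2 * t\<^sup>2 * (norm d)\<^sup>2" for t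
  define h' where "h' t = inner d (gradient g (x + t *\<^sub>R d)) - inner d (gradient g x) - L * t * (norm d)\<^sup>2" for t
  have line: "((\<lambda>t. g (x + t *\<^sub>R d)) has_real_derivative inner d (gradient g (x + t *\<^sub>R d))) (at t)" for t
  proof -
    have "(g has_derivative (\<lambda>h. inner h (gradient g (x + t *\<^sub>R d)))) (at (x + t *\<^sub>R d))"
      using GDERIV_gradient[OF assms(1)] by (simp add: gderiv_def)
    moreover have "((\<lambda>t. x + t *\<^sub>R d) has_derivative (\<lambda>s. s *\<^sub>R d)) (at t)"
      by (auto intro!: derivative_eq_intros)
    ultimately have "((\<lambda>t. g (x + t *\<^sub>R d)) has_derivative
        (\<lambda>s. inner (s *\<^sub>R d) (gradient g (x + t *\<^sub>R d)))) (at t)"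
      using has_derivative_compose by blast
    then show ?thesis
      by (simp add: has_field_derivative_def mult_commute_abs)
  qed
  have deriv: "(h has_real_derivative h' t) (at t)" for t
    unfolding h_def h'_def by (auto intro!: derivative_eq_intros line)
  have "h' t \<le> 0" if "0 \<le> t" for t
  proof -
    have "norm (gradient g (x + t *\<^sub>R d) - gradient g x) \<le> L * (t * norm d)"
      using lipschitz_onD[OF assms(2), of "x + t *\<^sub>R d" x] that by (simp add: dist_norm)
    then have "norm d * norm (gradient g (x + t *\<^sub>R d) - gradient g x) \<le> norm d * (L * (t * norm d))"
      by (rule mult_left_mono) simp
    with norm_cauchy_schwarz[of d "gradient g (x + t *\<^sub>R d) - gradient g x"]
    show ?thesis
      by (simp add: h'_def inner_diff_right power2_eq_square algebra_simps)
  qed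
  then have "h 1 \<le> h 0"
    using deriv by (intro DERIV_nonpos_imp_nonincreasing[of 0 1 h]) auto
  then show ?thesis
    by (simp add: h_def)
qed

text \<open>A gradient step from \<open>x\<close> cannot go below the minimum value
  \<open>g y\<close>, while the quadratic bound guarantees how far it descends.\<close>

lemma norm_gradient_le_gap:
  fixes g :: "'a::euclidean_space \<Rightarrow> real"
  assumes "\<And>x. g differentiable (at x)" and "L-lipschitz_on UNIV (gradient g)" and "L > 0"
    and "y \<in> global_minimizers g"
  shows "(norm (gradient g x))\<^sup>2 / (2 * L) \<le> g x - g y"
proof -
  let ?G = "gradient g x"
  \<comment> \<open>Among the multiples of \<open>?G\<close>, the factor \<open>- (1 / L)\<close>
    minimizes the quadratic bound.\<close>
  have "g y \<le> g (x + (- (1 / L)) *\<^sub>R ?G)"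
    using assms(4) by (simp add: global_minimizers_def is_arg_min_linorder)
  also have "\<dots> \<le> g x + inner ((- (1 / L)) *\<^sub>R ?G) ?G + L / 2 * (norm ((- (1 / L)) *\<^sub>R ?G))\<^sup>2"
    by (rule lipschitz_gradient_quadratic_upper_bound[OF assms(1,2)])
  also have "\<dots> = g x - (norm ?G)\<^sup>2 / (2 * L)"
    using \<open>L > 0\<close> by (simp add: power2_norm_eq_inner[symmetric] power_divide field_simps power2_eq_square)
  finally show ?thesis
    by simp
qed

lemma gradient_mean_loss:
  fixes l :: "nat \<Rightarrow> 'a::euclidean_space \<Rightarrow> real"
  assumes "\<And>i. i \<in> {1..n} \<Longrightarrow> l i differentiable (at x)"
  shows "gradient (mean_loss n l) x = (1 / real n) *\<^sub>R (\<Sum>i=1..n. gradient (l i) x)"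
proof (rule gradient_eqI)
  have "(l i has_derivative (\<lambda>h. inner h (gradient (l i) x))) (at x)" if "i \<in> {1..n}" for i
    using GDERIV_gradient[OF assms[OF that]] by (simp add: gderiv_def)
  then have "((\<lambda>x. (1 / real n) * (\<Sum>i=1..n. l i x)) has_derivative
      (\<lambda>h. (1 / real n) * (\<Sum>i=1..n. inner h (gradient (l i) x)))) (at x)"
    by (intro has_derivative_mult_right has_derivative_sum) auto
  moreover have "mean_loss n l = (\<lambda>x. (1 / real n) * (\<Sum>i=1..n. l i x))"
    by (simp add: mean_loss_def fun_eq_iff)
  ultimately show "GDERIV (mean_loss n l) x :> (1 / real n) *\<^sub>R (\<Sum>i=1..n. gradient (l i) x)"
    by (simp add: gderiv_def inner_sum_right)
qed

text \<open>Expanding the square leaves a cross term and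
  \<open>\<eta>\<^sup>2 * (norm ?G)\<^sup>2\<close>. The star-convexity inequality and the gap bound
  make the cross term at most \<open>- (\<eta> / L) * (norm ?G)\<^sup>2\<close>.\<close>

lemma sgd_step_decrease:
  fixes g :: "'a::euclidean_space \<Rightarrow> real"
  assumes "\<And>x. g differentiable (at x)" and "L-lipschitz_on UNIV (gradient g)" and "L > 0"
    and "y \<in> global_minimizers g" and "\<eta> > 0"
    and "g x - g y + inner (y - x) (gradient g x) \<le> 0"
  shows "\<eta> * (1 / L - \<eta>) * (norm (gradient g x))\<^sup>2
    \<le> (norm (x - y))\<^sup>2 - (norm (x - \<eta> *\<^sub>R gradient g x - y))\<^sup>2"
proof -
  let ?G = "gradient g x"
  have "(norm (x - \<eta> *\<^sub>R ?G - y))\<^sup>2 = (norm (x - y))\<^sup>2 + 2 * \<eta> * inner (y - x) ?G + \<eta>\<^sup>2 * (norm ?G)\<^sup>2"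
    unfolding power2_norm_eq_inner
    by (simp add: inner_diff_left inner_diff_right inner_commute power2_eq_square algebra_simps)
  moreover have "(norm ?G)\<^sup>2 / (2 * L) \<le> - inner (y - x) ?G"
    using norm_gradient_le_gap[OF assms(1-4), of x] assms(6) by linarith
  then have "2 * \<eta> * ((norm ?G)\<^sup>2 / (2 * L)) \<le> 2 * \<eta> * (- inner (y - x) ?G)"
    using \<open>\<eta> > 0\<close> by (intro mult_left_mono) auto
  ultimately show ?thesis
    by (simp add: power2_eq_square algebra_simps)
qed

text \<open>A decreasing sequence bounded below converges, so its successive differences vanish and
  squeeze \<open>a\<close>.\<close>

lemma tendsto_zero_if_le_decrease:
  fixes a D :: "nat \<Rightarrow> real"
  assumes "\<And>k. 0 \<le> a k" and "\<And>k. 0 \<le> D k" and "\<And>k. a k \<le> D k - D (Suc k)"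
  shows "a \<longlonglongrightarrow> 0"
proof -
  have "decseq D"
    by (rule decseq_SucI) (metis assms(1,3) diff_ge_0_iff_ge order_trans)
  then obtain c where c: "D \<longlonglongrightarrow> c"
    using decseq_convergent[of D 0] assms(2) by blast
  have "(\<lambda>k. D k - D (Suc k)) \<longlonglongrightarrow> c - c"
    by (intro tendsto_diff c LIMSEQ_Suc)
  then show ?thesis
    by (intro tendsto_sandwich[of "\<lambda>_. 0" a sequentially "\<lambda>k. D k - D (Suc k)"])
       (use assms in auto)
qed

lemma cyclic_sampling_visits:
  assumes "cyclic_sampling_with_reshuffle n p \<xi>" and "i \<in> {1..n}"
  obtains m where "k \<le> m" and "m < k + 2 * n" and "\<xi> m = i"
proof -
  \<comment> \<open>The epoch after that of \<open>k\<close> is taken, since \<open>i\<close> may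
    already have occurred in the current one before \<open>k\<close>. At most \<open>n\<close>
    iterations remain of the current epoch and the next has \<open>n\<close>, whence
    \<open>2 * n\<close>.\<close>
  define B where "B = Suc (k div n)"
  have "p B permutes {1..n}"
    using assms(1) by (simp add: cyclic_sampling_with_reshuffle_def)
  then have "i \<in> p B ` {1..n}"
    using assms(2) by (simp add: permutes_image)
  then obtain j where "j \<in> {1..n}" and "p B j = i"
    by auto
  \<comment> \<open>The permutation acts on \<open>{1..n}\<close> but positions start at 0;
    \<open>j \<ge> 1\<close> makes the truncated subtraction exact.\<close>
  then have "j - 1 < n" and "j - 1 + 1 = j"
    by auto
  then have "\<xi> (n * B + (j - 1)) = i"
    using assms(1) \<open>p B j = i\<close> unfolding cyclic_sampling_with_reshuffle_def by metis
  moreover have "n * (k div n) + k mod n = k" and "k mod n < n"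
    using assms(2) by auto
  then have "k \<le> n * B + (j - 1)" and "n * B + (j - 1) < k + 2 * n"
    using \<open>j - 1 < n\<close> unfolding B_def mult_Suc_right by linarith+
  ultimately show ?thesis
    using that by blast
qed

lemma cyclic_sampling_index_range:
  assumes "cyclic_sampling_with_reshuffle n p \<xi>" and "n \<ge> 1"
  shows "\<xi> k \<in> {1..n}"
proof -
  have "k mod n < n"
    using assms(2) by simp
  then have "\<xi> (n * (k div n) + k mod n) = p (k div n) (k mod n + 1)"
    and "p (k div n) permutes {1..n}"
    using assms(1) unfolding cyclic_sampling_with_reshuffle_def by blast+
  then show ?thesis
    using permutes_in_image[of "p (k div n)" "{1..n}" "k mod n + 1"] \<open>k mod n < n\<close> by auto
qed

text \<open>The lag telescopes into at most \<open>N\<close> increments. Padding to exactly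
  \<open>N\<close> terms gives a finite sum of null sequences whose length does not depend on
  \<open>k\<close>.\<close>

lemma bounded_lag_tendsto_zero:
  fixes x :: "nat \<Rightarrow> 'a::real_normed_vector"
  assumes "(\<lambda>k. x (Suc k) - x k) \<longlonglongrightarrow> 0"
    and "\<And>k. k \<le> m k" and "\<And>k. m k \<le> k + N"
  shows "(\<lambda>k. x (m k) - x k) \<longlonglongrightarrow> 0"
proof (rule tendsto_0_le[where K = 1])
  have "(\<lambda>k. \<Sum>j<N. norm (x (Suc (k + j)) - x (k + j))) \<longlonglongrightarrow> (\<Sum>j<N. 0)"
    using LIMSEQ_ignore_initial_segment[OF tendsto_norm_zero[OF assms(1)]]
    by (intro tendsto_sum) simp
  then show "(\<lambda>k. \<Sum>j<N. norm (x (Suc (k + j)) - x (k + j))) \<longlonglongrightarrow> 0"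
    by simp
  have "norm (x (m k) - x k) \<le> (\<Sum>j<N. norm (x (Suc (k + j)) - x (k + j)))" for k
  proof -
    have "x (m k) - x k = (\<Sum>j<m k - k. x (Suc (k + j)) - x (k + j))"
      using sum_lessThan_telescope[of "\<lambda>j. x (k + j)" "m k - k"] assms(2)[of k] by simp
    also have "norm \<dots> \<le> (\<Sum>j<m k - k. norm (x (Suc (k + j)) - x (k + j)))"
      by (rule norm_sum)
    also have "\<dots> \<le> (\<Sum>j<N. norm (x (Suc (k + j)) - x (k + j)))"
      using assms(3)[of k] by (intro sum_mono2) auto
    finally show ?thesis .
  qed
  then show "\<forall>\<^sub>F k in sequentially. norm (x (m k) - x k)
      \<le> norm (\<Sum>j<N. norm (x (Suc (k + j)) - x (k + j))) * 1"
    by (auto intro!: always_eventually order_trans[OF _ abs_ge_self])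
qed

theorem corollary1:
  fixes n :: nat
    and l :: "nat \<Rightarrow> real ^ 'd \<Rightarrow> real"
    and L \<eta> :: real
    and p :: "nat \<Rightarrow> nat \<Rightarrow> nat"
    and \<xi> :: "nat \<Rightarrow> nat"
    and x0 :: "real ^ 'd"
    and x :: "nat \<Rightarrow> real ^ 'd"
  assumes "n \<ge> 1"
    and "L > 0"
    and "\<And>i. i \<in> {1..n} \<Longrightarrow> continuously_differentiable (l i)"
    and "\<And>i. i \<in> {1..n} \<Longrightarrow> L-lipschitz_on UNIV (gradient (l i))"
    and "\<And>i. i \<in> {1..n} \<Longrightarrow> bdd_below (range (l i))"
    and "(\<Inter>i\<in>{1..n}. global_minimizers (l i)) \<noteq> {}"
    and "bounded (\<Inter>i\<in>{1..n}. global_minimizers (l i))"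
    and "0 < \<eta>" and "\<eta> < 1 / L"
    and "cyclic_sampling_with_reshuffle n p \<xi>"
    and "sgd_sequence l \<eta> \<xi> x0 x"
    and "iterationwise_star_convex_path l \<xi> x"
  shows "(\<lambda>k. stochastic_gradient_variance n l (x k)) \<longlonglongrightarrow> 0"
proof -
  let ?G = "\<lambda>k. gradient (l (\<xi> k)) (x k)"
  have diff: "l i differentiable (at y)" if "i \<in> {1..n}" for i y
    using assms(3)[OF that] by (simp add: continuously_differentiable_def)
  have \<xi>: "\<xi> k \<in> {1..n}" for k
    using cyclic_sampling_index_range assms(1,10) by blast
  have step: "x (Suc k) = x k - \<eta> *\<^sub>R ?G k" for k
    using assms(11) by (simp add: sgd_sequence_def)
  \<comment> \<open>One reference point must serve every sampled loss, so that the decreases of the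
    squared distance chain across iterations.\<close>
  obtain y where y: "\<And>i. i \<in> {1..n} \<Longrightarrow> y \<in> global_minimizers (l i)"
    using assms(6) by blast
  \<comment> \<open>The decrease factor of one step; its positivity is where
    \<open>\<eta> < 1 / L\<close> enters.\<close>
  define c where "c = \<eta> * (1 / L - \<eta>)"
  have "c > 0"
    using assms(8,9) by (simp add: c_def)
  have "c * (norm (?G k))\<^sup>2 \<le> (norm (x k - y))\<^sup>2 - (norm (x (Suc k) - y))\<^sup>2" for k
    using sgd_step_decrease[OF diff[OF \<xi>] assms(4)[OF \<xi>] assms(2) y[OF \<xi>] assms(8), of k "x k"]
      assms(12) y[OF \<xi>] unfolding c_def step iterationwise_star_convex_path_def by blast
  then have "(\<lambda>k. c * (norm (?G k))\<^sup>2) \<longlonglongrightarrow> 0"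
    using \<open>c > 0\<close> by (intro tendsto_zero_if_le_decrease[where D = "\<lambda>k. (norm (x k - y))\<^sup>2"]) auto
  then have "(\<lambda>k. (norm (?G k))\<^sup>2) \<longlonglongrightarrow> 0"
    using tendsto_mult_left_iff[of c "\<lambda>k. (norm (?G k))\<^sup>2" 0] \<open>c > 0\<close> by simp
  then have sampled: "?G \<longlonglongrightarrow> 0"
    by (simp add: tendsto_null_power tendsto_norm_zero_iff power_tendsto_0_iff)
  then have "(\<lambda>k. - (\<eta> *\<^sub>R ?G k)) \<longlonglongrightarrow> - (\<eta> *\<^sub>R 0)"
    by (intro tendsto_intros)
  then have increments: "(\<lambda>k. x (Suc k) - x k) \<longlonglongrightarrow> 0"
    by (simp add: step)
  have grad: "(\<lambda>k. gradient (l i) (x k)) \<longlonglongrightarrow> 0" if i: "i \<in> {1..n}" for i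
  proof -
    \<comment> \<open>\<open>m k\<close> is a time at or after \<open>k\<close> at which
      \<open>i\<close> is sampled; there the gradient of \<open>l i\<close> is a sampled gradient,
      and the bounded lag carries it back to \<open>x k\<close>.\<close>
    have "\<exists>m. \<forall>k. k \<le> m k \<and> m k < k + 2 * n \<and> \<xi> (m k) = i"
      using cyclic_sampling_visits[OF assms(10) i] by (intro choice) metis
    then obtain m where m: "\<And>k. k \<le> m k" "\<And>k. m k < k + 2 * n" "\<And>k. \<xi> (m k) = i"
      by blast
    have "(\<lambda>k. x (m k) - x k) \<longlonglongrightarrow> 0"
      using bounded_lag_tendsto_zero[OF increments m(1) less_imp_le[OF m(2)]] .
    moreover have "norm (gradient (l i) (x (m k)) - gradient (l i) (x k)) \<le> norm (x (m k) - x k) * L" for k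
      using lipschitz_onD[OF assms(4)[OF i], of "x (m k)" "x k"] by (simp add: dist_norm mult.commute)
    ultimately have lag: "(\<lambda>k. gradient (l i) (x (m k)) - gradient (l i) (x k)) \<longlonglongrightarrow> 0"
      by (blast intro: tendsto_0_le[where K = L] always_eventually)
    \<comment> \<open>The values of \<open>m\<close> may repeat, so it need not be a subsequence
      selector; divergence to infinity is enough to compose with \<open>sampled\<close>.\<close>
    have "filterlim m at_top sequentially"
      using m(1) by (intro filterlim_at_top_mono[OF filterlim_ident]) auto
    from filterlim_compose[OF sampled this]
    have "(\<lambda>k. gradient (l i) (x (m k))) \<longlonglongrightarrow> 0"
      by (simp add: m(3))
    from tendsto_diff[OF this lag] show ?thesis
      by simp
  qed
  \<comment> \<open>With the gradient of the mean written as the mean of the gradients, the variance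
    is a continuous expression in finitely many null sequences; its limit is its value at
    zero.\<close>
  have "(\<lambda>k. (1 / real n) * (\<Sum>i=1..n. (norm (gradient (l i) (x k)
      - (1 / real n) *\<^sub>R (\<Sum>j=1..n. gradient (l j) (x k))))\<^sup>2))
    \<longlonglongrightarrow> (1 / real n) * (\<Sum>i=1..n. (norm ((0 :: real ^ 'd) - (1 / real n) *\<^sub>R (\<Sum>j=1..n. 0)))\<^sup>2)"
    by (intro tendsto_intros grad)
  moreover have "gradient (mean_loss n l) y = (1 / real n) *\<^sub>R (\<Sum>j=1..n. gradient (l j) y)" for y
    by (rule gradient_mean_loss) (rule diff)
  ultimately show ?thesis
    by (simp add: stochastic_gradient_variance_def)
qed

end
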